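(* Let $n\ge 2$ be an integer. (a) The set $\{A\subseteq n^{<\omega} : A^\infty=\emptyset\}$ equals $\{\emptyset,\{\emptyset\}\}$ (the empty dictionary and the dictionary whose only element is the empty word), and it is $\mathbf{\Pi}^0_1$-complete. (b) The set $\{A\subseteq n^{<\omega} : A^\infty=n^\omega\}$ is a dense $\mathbf{\Sigma}^0_1$ (open) subset of $2^{n^{<\omega}}$. In particular, it is $\mathbf{\Sigma}^0_1$-complete. (c) The set $\{A\subseteq n^{<\omega} : A^\infty\in\mathbf{\Delta}^0_1\}$ (i.e. $A^\infty$ is clopen in $n^\omega$) is a $K_\sigma$ subset of $2^{n^{<\omega}}$ which is not $\mathbf{\Pi}^0_2$. In particular, it is $\mathbf{\Sigma}^0_2$-complete.
   Context: $n=\{0,\dots,n-1\}$ is a finite alphabet, $n^{<\omega}$ is the set of finite words over it (including the empty word $\emptyset$), and $n^\omega$ has the product topology. For $A\subseteq n^{<\omega}$, $A^\infty:=\{a_0a_1a_2\ldots\in n^\omega : \forall i\in\omega\ a_i\in A\}$. Subsets of $n^{<\omega}$ are identified with points of the compact space $2^{n^{<\omega}}$ with the product topology. For a class $\Gamma$, a set $C\subseteq X$ ($X$ a zero-dimensional Polish space) is $\Gamma$-complete if $C\in\Gamma(X)$ and every $\Gamma$ subset of every zero-dimensional Polish space $Y$ is the preimage of $C$ under some continuous map $Y\to X$. $K_\sigma$ means countable union of compact sets. *)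

theory Defs
  imports "HOL-Analysis.Analysis"
begin

definition words :: "nat \<Rightarrow> nat list set"
  where "words n = lists {..<n}"

definition omega_space :: "nat \<Rightarrow> (nat \<Rightarrow> nat) topology"
  where "omega_space n = product_topology (\<lambda>_. discrete_topology {..<n}) UNIV"

text \<open>The sequence \<open>a\<close> may contain empty words; it has a concatenation in \<open>n\<^sup>\<omega>\<close> only if
  the lengths of the finite partial concatenations are unbounded.\<close>

definition is_concat :: "(nat \<Rightarrow> nat list) \<Rightarrow> (nat \<Rightarrow> nat) \<Rightarrow> bool"
  where "is_concat a x \<longleftrightarrow>
    (\<forall>k. concat (map a [0..<k]) = map x [0..<length (concat (map a [0..<k]))]) \<and>
    (\<forall>m. \<exists>k. m \<le> length (concat (map a [0..<k])))"

definition omega_power :: "nat \<Rightarrow> nat list set \<Rightarrow> (nat \<Rightarrow> nat) set"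
  where "omega_power n A =
    {x \<in> topspace (omega_space n). \<exists>a. (\<forall>i. a i \<in> A) \<and> is_concat a x}"

text \<open>The product topology on \<open>{0,1}\<close>-valued functions on finite words, transported to sets of
  words along characteristic functions.  Functions on the index set are extensional in the
  library's products, hence \<open>restrict\<close>.\<close>

definition dict_space :: "nat \<Rightarrow> nat list set topology"
  where "dict_space n =
    pullback_topology (Pow (words n)) (\<lambda>A. restrict (\<lambda>w. w \<in> A) (words n))
      (product_topology (\<lambda>_. discrete_topology (UNIV :: bool set)) (words n))"

definition zero_dim_polish :: "'a topology \<Rightarrow> bool"
  where "zero_dim_polish X \<longleftrightarrow>
    completely_metrizable_space X \<and> separable_space X \<and>
    (\<forall>U x. openin X U \<and> x \<in> U \<longrightarrow> (\<exists>V. openin X V \<and> closedin X V \<and> x \<in> V \<and> V \<subseteq> U))"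

definition k_sigma_in :: "'a topology \<Rightarrow> 'a set \<Rightarrow> bool"
  where "k_sigma_in X = countable union_of compactin X"

text \<open>Names for the classes, so that one class can be interpreted in spaces of different types.\<close>

datatype pointclass = Sigma01 | Pi01 | Sigma02 | Pi02

primrec in_class :: "pointclass \<Rightarrow> 'a topology \<Rightarrow> 'a set \<Rightarrow> bool" where
  "in_class Sigma01 X = openin X"
| "in_class Pi01 X = closedin X"
| "in_class Sigma02 X = fsigma_in X"
| "in_class Pi02 X = gdelta_in X"

text \<open>A definition cannot quantify over types, so the type carrying the test spaces \<open>Y\<close> is a
  parameter.  A theorem asserting completeness for \<open>TYPE('b)\<close> with \<open>'b\<close> a type variable covers
  zero-dimensional Polish spaces over every type.\<close>

definition class_complete ::
    "'b itself \<Rightarrow> pointclass \<Rightarrow> 'a topology \<Rightarrow> 'a set \<Rightarrow> bool"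
  where "class_complete _ \<Gamma> X C \<longleftrightarrow>
    zero_dim_polish X \<and> in_class \<Gamma> X C \<and>
    (\<forall>(Y :: 'b topology) D. zero_dim_polish Y \<and> in_class \<Gamma> Y D \<longrightarrow>
       (\<exists>f. continuous_map Y X f \<and> D = {y \<in> topspace Y. f y \<in> C}))"

end

theory Submission
  imports Defs "HOL-Library.Omega_Words_Fun"
begin

text \<open>
  Everything rests on describing the \<open>\<omega>\<close>-power \<open>A\<^sup>\<infinity>\<close> as the greatest set \<open>X\<close> of infinite words in
  which every point is a nonempty word of \<open>A\<close> followed by a point of \<open>X\<close>
  (\<open>omega_power_unfold\<close>, \<open>omega_power_coinduct\<close>).  In particular \<open>A\<^sup>\<infinity>\<close> is empty exactly
  when \<open>A\<close> has no nonempty word, and two dictionaries satisfy that: this set is finite, hence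
  closed.

  If \<open>C = A\<^sup>\<infinity>\<close> is clopen, then it is compact and covered by the open sets \<open>w C\<close> with \<open>w\<close> a nonempty
  word of \<open>A\<close>; finitely many of them suffice, and by coinduction these finitely many words already
  generate \<open>C\<close> (\<open>finite_generators\<close>).  Applied to \<open>C = n\<^sup>\<omega>\<close> this shows that membership of
  \<open>A\<close> in the second set is forced by finitely many words of \<open>A\<close>, so the set is open; it is dense because adding
  all words of one large length to \<open>A\<close> makes the power full.  For arbitrary clopen \<open>C\<close> it shows that
  the third set is the union, over the countably many finite \<open>B\<close> with \<open>B\<^sup>\<infinity>\<close> clopen, of the sets
  \<open>{A. B \<subseteq> A \<and> A\<^sup>\<infinity> = B\<^sup>\<infinity>}\<close>.  Each of these is closed in a compact space, because failure of \<open>A\<^sup>\<infinity> = B\<^sup>\<infinity>\<close>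
  for \<open>A \<supseteq> B\<close> is witnessed by a single word of \<open>A\<close> (\<open>closedin_same_omega_power\<close>).

  For hardness, an open set in a zero-dimensional Polish space is a countable union of clopen sets
  \<open>V 0, V 1, \<dots>\<close>.  Putting all words of length \<open>i + 1\<close> into the dictionary of \<open>y\<close> whenever
  \<open>y \<in> V i\<close> gives a full power if \<open>y\<close> is in the open set and an empty one otherwise; this single map
  reduces to the second set, and, for complements, to the first.  For the third
  set, an \<open>F\<^sub>\<sigma>\<close> set is first reduced to finiteness of a set \<open>K y\<close> of natural numbers with
  clopen dependence on \<open>y\<close> (\<open>fsigma_finite_reduction\<close>), and then finiteness of \<open>K\<close> is turned into
  clopenness of the power of an explicit dictionary in which the point \<open>0111\<dots>\<close> is a missing limit
  exactly when \<open>K\<close> is infinite (\<open>closedin_stem_dictionary_power_iff\<close>).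

  Finally, the set of finite dictionaries is countable and dense in a space without isolated points,
  so by Baire's theorem it is \<open>F\<^sub>\<sigma>\<close> but not \<open>G\<^sub>\<delta>\<close>.  As it reduces to the third set, that set is not
  \<open>G\<^sub>\<delta>\<close> either.
\<close>

section \<open>The \<open>\<omega>\<close>-power as a greatest fixed point\<close>

lemma topspace_omega_space: "topspace (omega_space n) = {x. range x \<subseteq> {..<n}}"
  by (auto simp: omega_space_def PiE_def Pi_def)

lemma topspace_dict_space [simp]: "topspace (dict_space n) = Pow (words n)"
  by (auto simp: dict_space_def topspace_pullback_topology)

lemma conc_in_omega_space [simp]:
  "w \<frown> x \<in> topspace (omega_space n) \<longleftrightarrow> w \<in> words n \<and> x \<in> topspace (omega_space n)"
  by (auto simp: topspace_omega_space words_def in_lists_conv_set)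

lemma countable_words: "countable (words n)"
  by (simp add: words_def)

lemma omega_power_subset_topspace: "omega_power n A \<subseteq> topspace (omega_space n)"
  by (auto simp: omega_power_def)

lemma omega_power_mono: "A \<subseteq> B \<Longrightarrow> omega_power n A \<subseteq> omega_power n B"
  by (fastforce simp: omega_power_def)

lemma is_concat_iff:
  "is_concat a x \<longleftrightarrow>
    (\<forall>k. \<exists>z. x = concat (map a [0..<k]) \<frown> z) \<and>
    (\<forall>m. \<exists>k. m \<le> length (concat (map a [0..<k])))"
proof -
  have "w = map x [0..<length w] \<longleftrightarrow> (\<exists>z. x = w \<frown> z)" for w
    by (metis (no_types) prefix_conc_length prefix_suffix subsequence_def)
  then show ?thesis
    by (simp add: is_concat_def)
qed

text \<open>
  The leading empty words of a sequence of words contribute nothing, and only finitely many of them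
  precede the first nonempty one; dropping them is what makes the first word here nonempty.
\<close>

lemma omega_power_unfold:
  assumes "x \<in> omega_power n A"
  obtains w z where "w \<in> A" "w \<noteq> []" "z \<in> omega_power n A" "x = w \<frown> z"
proof -
  obtain a where x: "x \<in> topspace (omega_space n)" and aA: "\<And>i. a i \<in> A" and a: "is_concat a x"
    using assms by (auto simp: omega_power_def)
  obtain m where "1 \<le> length (concat (map a [0..<m]))"
    using a unfolding is_concat_iff by blast
  then have "\<exists>k. a k \<noteq> []"
    by (auto simp: Suc_le_eq)
  define k where "k = (LEAST k. a k \<noteq> [])"
  have ak: "a k \<noteq> []"
    unfolding k_def using \<open>\<exists>k. a k \<noteq> []\<close> by (rule LeastI_ex)
  have empty: "a i = []" if "i < k" for i
    using not_less_Least that unfolding k_def by blast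
  define b where "b i = a (Suc k + i)" for i
  have split: "concat (map a [0..<Suc k + j]) = a k @ concat (map b [0..<j])" for j
  proof -
    have "map a [Suc k..<Suc k + j] = map b [0..<j]"
      by (rule nth_equalityI) (simp_all add: b_def del: upt_Suc)
    then have "map a [0..<Suc k + j] = map a [0..<k] @ a k # map b [0..<j]"
      by (subst upt_add_eq_append) (simp_all del: add_Suc)
    moreover have "concat (map a [0..<k]) = []"
      using empty by simp
    ultimately show ?thesis
      by simp
  qed
  define z where "z = suffix (length (a k)) x"
  have xz: "x = a k \<frown> z"
  proof -
    obtain y where "x = concat (map a [0..<Suc k + 0]) \<frown> y"
      using a unfolding is_concat_iff by blast
    then show ?thesis
      unfolding split z_def by simp
  qed
  have "is_concat b z"
    unfolding is_concat_iff
  proof (intro conjI allI)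
    fix j
    obtain y where "x = concat (map a [0..<Suc k + j]) \<frown> y"
      using a unfolding is_concat_iff by blast
    then have "a k \<frown> z = a k \<frown> concat (map b [0..<j]) \<frown> y"
      unfolding split xz by simp
    then show "\<exists>y. z = concat (map b [0..<j]) \<frown> y"
      by blast
  next
    fix m
    obtain j where j: "length (a k) + m \<le> length (concat (map a [0..<j]))"
      using a unfolding is_concat_iff by blast
    also have "\<dots> \<le> length (concat (map a [0..<Suc k + j]))"
      by (subst add.commute, subst upt_add_eq_append) auto
    finally have "m \<le> length (concat (map b [0..<j]))"
      unfolding split by simp
    then show "\<exists>j. m \<le> length (concat (map b [0..<j]))" ..
  qed
  moreover have "\<forall>i. b i \<in> A" and "z \<in> topspace (omega_space n)"
    using x xz aA by (auto simp: b_def)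
  ultimately have "z \<in> omega_power n A"
    unfolding omega_power_def by blast
  then show thesis
    using that aA ak xz by blast
qed

text \<open>
  Nonemptiness of \<open>w\<close> is essential: iterating the decomposition then produces partial
  concatenations of unbounded length.
\<close>

lemma omega_power_coinduct:
  assumes "X \<subseteq> topspace (omega_space n)" and "x \<in> X"
    and step: "\<And>x. x \<in> X \<Longrightarrow> \<exists>w\<in>A. w \<noteq> [] \<and> (\<exists>z\<in>X. x = w \<frown> z)"
  shows "x \<in> omega_power n A"
proof -
  obtain w z where w: "\<And>x. x \<in> X \<Longrightarrow> w x \<in> A \<and> w x \<noteq> [] \<and> z x \<in> X \<and> x = w x \<frown> z x"
    using step by metis
  \<comment> \<open>the tail that remains after splitting off \<open>i\<close> words\<close>
  define s where "s i = (z ^^ i) x" for i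
  have s: "s i \<in> X" for i
    by (induction i) (auto simp: s_def w \<open>x \<in> X\<close>)
  define a where "a i = w (s i)" for i
  have "x = concat (map a [0..<k]) \<frown> s k" for k
  proof (induction k)
    case (Suc k)
    have "s k = a k \<frown> s (Suc k)"
      using w[OF s[of k]] by (simp add: s_def a_def)
    then show ?case
      using Suc by simp
  qed (simp add: s_def)
  moreover have "k \<le> length (concat (map a [0..<k]))" for k
  proof (induction k)
    case (Suc k)
    have "a k \<noteq> []"
      using w s by (simp add: a_def)
    then have "1 \<le> length (a k)"
      by (simp add: Suc_le_eq)
    with Suc show ?case
      by simp
  qed simp
  ultimately have "is_concat a x"
    unfolding is_concat_iff by blast
  moreover have "\<forall>i. a i \<in> A"
    using w s by (simp add: a_def)
  ultimately show ?thesis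
    using assms unfolding omega_power_def by blast
qed

lemma omega_power_conc:
  assumes "A \<subseteq> words n" "w \<in> A" "z \<in> omega_power n A"
  shows "w \<frown> z \<in> omega_power n A"
proof (cases "w = []")
  case False
  show ?thesis
  proof (rule omega_power_coinduct)
    show "insert (w \<frown> z) (omega_power n A) \<subseteq> topspace (omega_space n)"
      using assms omega_power_subset_topspace by auto
    show "\<exists>v\<in>A. v \<noteq> [] \<and> (\<exists>y\<in>insert (w \<frown> z) (omega_power n A). x = v \<frown> y)"
      if "x \<in> insert (w \<frown> z) (omega_power n A)" for x
      using that False assms by (metis insert_iff omega_power_unfold)
  qed simp
qed (use assms in simp)

text \<open>
  A single nonempty word \<open>w\<close> already generates the periodic point \<open>w\<^sup>\<omega>\<close>.
\<close>

lemma omega_power_eq_empty_iff: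
  assumes "A \<subseteq> words n"
  shows "omega_power n A = {} \<longleftrightarrow> A \<subseteq> {[]}"
proof
  assume "omega_power n A = {}"
  have False if "w \<in> A" "w \<noteq> []" for w
  proof -
    have "set w \<subseteq> {..<n}"
      using assms that by (auto simp: words_def)
    then have "w ! (i mod length w) \<in> {..<n}" for i
      using that(2) nth_mem[of "i mod length w" w] by (simp add: subset_iff)
    then have "w\<^sup>\<omega> \<in> topspace (omega_space n)"
      using that(2) by (auto simp: topspace_omega_space)
    then have "w\<^sup>\<omega> \<in> omega_power n A"
      using iter_unroll[of w] that by (intro omega_power_coinduct[of "{w\<^sup>\<omega>}"]) auto
    with \<open>omega_power n A = {}\<close> show False by simp
  qed
  then show "A \<subseteq> {[]}" by blast
next
  assume "A \<subseteq> {[]}"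
  then show "omega_power n A = {}"
    using omega_power_unfold by blast
qed

section \<open>The space of dictionaries\<close>

text \<open>
  Openness, closedness and density of sets of dictionaries are checked through this description: near
  \<open>A\<close>, only the membership of finitely many words is constrained.
\<close>

lemma openin_dict_space:
  "openin (dict_space n) U \<longleftrightarrow>
    U \<subseteq> Pow (words n) \<and>
    (\<forall>A\<in>U. \<exists>F. finite F \<and> F \<subseteq> words n \<and> (\<forall>A'\<subseteq>words n. A' \<inter> F = A \<inter> F \<longrightarrow> A' \<in> U))"
  (is "?lhs \<longleftrightarrow> ?rhs")
proof
  let ?P = "product_topology (\<lambda>_. discrete_topology (UNIV :: bool set)) (words n)"
  let ?\<chi> = "\<lambda>A. restrict (\<lambda>w. w \<in> A) (words n)"
  {
    assume ?lhs
    then obtain V where V: "openin ?P V" "U = ?\<chi> -` V \<inter> Pow (words n)"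
      by (auto simp: dict_space_def openin_pullback_topology)
    show ?rhs
    proof (intro conjI ballI)
      fix A assume "A \<in> U"
      then have "?\<chi> A \<in> V" using V by auto
      then obtain W where W: "finite {w \<in> words n. W w \<noteq> UNIV}" "?\<chi> A \<in> Pi\<^sub>E (words n) W"
          "Pi\<^sub>E (words n) W \<subseteq> V"
        using V(1) unfolding openin_product_topology_alt by auto
      let ?F = "{w \<in> words n. W w \<noteq> UNIV}"
      have "A' \<in> U" if "A' \<subseteq> words n" "A' \<inter> ?F = A \<inter> ?F" for A'
      proof -
        have "(w \<in> A') \<in> W w" if "w \<in> words n" for w
        proof (cases "W w = UNIV")
          case False
          then have "w \<in> A' \<longleftrightarrow> w \<in> A"
            using that \<open>A' \<inter> ?F = A \<inter> ?F\<close> by blast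
          then show ?thesis
            using W(2) that by (auto simp: PiE_iff)
        qed simp
        then have "?\<chi> A' \<in> V"
          using W(3) by (auto simp: PiE_iff)
        then show ?thesis
          using V that by auto
      qed
      then show "\<exists>F. finite F \<and> F \<subseteq> words n \<and> (\<forall>A'\<subseteq>words n. A' \<inter> F = A \<inter> F \<longrightarrow> A' \<in> U)"
        using W(1) by (intro exI[of _ ?F]) auto
    qed (use V in auto)
  }
  assume R: ?rhs
  have "openin ?P (?\<chi> ` U)"
    unfolding openin_product_topology_alt
  proof
    fix f assume "f \<in> ?\<chi> ` U"
    then obtain A where A: "A \<in> U" "f = ?\<chi> A" by auto
    then obtain F where F: "finite F" "F \<subseteq> words n"
        "\<And>A'. A' \<subseteq> words n \<Longrightarrow> A' \<inter> F = A \<inter> F \<Longrightarrow> A' \<in> U"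
      using R by blast
    define W where "W w = (if w \<in> F then {w \<in> A} else UNIV)" for w
    have "Pi\<^sub>E (words n) W \<subseteq> ?\<chi> ` U"
    proof
      fix g assume g: "g \<in> Pi\<^sub>E (words n) W"
      let ?A = "{w \<in> words n. g w}"
      have "g w \<longleftrightarrow> w \<in> A" if "w \<in> F" for w
        using g that F(2) by (force simp: PiE_iff W_def)
      then have "?A \<in> U"
        using F(2) by (intro F(3)) auto
      moreover have "g = ?\<chi> ?A"
        using g by (intro ext) (auto simp: PiE_iff extensional_def)
      ultimately show "g \<in> ?\<chi> ` U" by blast
    qed
    moreover have "finite {w \<in> words n. W w \<noteq> UNIV}"
      by (rule finite_subset[OF _ F(1)]) (auto simp: W_def)
    ultimately show "\<exists>W. finite {w \<in> words n. W w \<noteq> topspace (discrete_topology UNIV)} \<and>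
        (\<forall>w\<in>words n. openin (discrete_topology UNIV) (W w)) \<and>
        f \<in> Pi\<^sub>E (words n) W \<and> Pi\<^sub>E (words n) W \<subseteq> ?\<chi> ` U"
      using A by (intro exI[of _ W]) (auto simp: W_def)
  qed
  moreover have "U = ?\<chi> -` (?\<chi> ` U) \<inter> Pow (words n)"
  proof -
    have "inj_on ?\<chi> (Pow (words n))"
    proof (rule inj_onI)
      fix A B assume AB: "A \<in> Pow (words n)" "B \<in> Pow (words n)" and eq: "?\<chi> A = ?\<chi> B"
      have "w \<in> A \<longleftrightarrow> w \<in> B" if "w \<in> words n" for w
        using fun_cong[OF eq, of w] that by simp
      with AB show "A = B"
        by blast
    qed
    moreover have "U \<subseteq> Pow (words n)"
      using R by simp
    ultimately have "?\<chi> A \<in> ?\<chi> ` U \<longleftrightarrow> A \<in> U" if "A \<in> Pow (words n)" for A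
      using that by (intro inj_on_image_mem_iff)
    with \<open>U \<subseteq> Pow (words n)\<close> show ?thesis
      unfolding vimage_def by blast
  qed
  ultimately show ?lhs
    unfolding dict_space_def openin_pullback_topology by blast
qed

lemma openin_dict_spaceE:
  assumes "openin (dict_space n) U" and "A \<in> U"
  obtains F where "finite F" "F \<subseteq> words n"
    "\<forall>A'\<subseteq>words n. A' \<inter> F = A \<inter> F \<longrightarrow> A' \<in> U"
proof -
  have "\<exists>F. finite F \<and> F \<subseteq> words n \<and> (\<forall>A'\<subseteq>words n. A' \<inter> F = A \<inter> F \<longrightarrow> A' \<in> U)"
    using assms unfolding openin_dict_space by (elim conjE) (rule bspec)
  then show thesis
    using that by blast
qed

lemma dict_space_homeomorphic_product:
  "dict_space n homeomorphic_space
    product_topology (\<lambda>_. discrete_topology (UNIV :: bool set)) (words n)"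
proof -
  let ?P = "product_topology (\<lambda>_. discrete_topology (UNIV :: bool set)) (words n)"
  let ?\<chi> = "\<lambda>A. restrict (\<lambda>w. w \<in> A) (words n)"
  have "continuous_map (dict_space n) ?P (id \<circ> ?\<chi>)"
    unfolding dict_space_def by (intro continuous_map_pullback continuous_map_id)
  moreover have "continuous_map ?P (dict_space n) (\<lambda>f. {w \<in> words n. f w})"
    unfolding dict_space_def
  proof (rule continuous_map_pullback')
    show "continuous_map ?P ?P (?\<chi> \<circ> (\<lambda>f. {w \<in> words n. f w}))"
      by (rule continuous_map_eq[OF continuous_map_id])
        (auto simp: fun_eq_iff PiE_iff extensional_def)
  qed auto
  ultimately have "homeomorphic_maps (dict_space n) ?P ?\<chi> (\<lambda>f. {w \<in> words n. f w})"
    by (auto simp: homeomorphic_maps_def fun_eq_iff PiE_iff extensional_def restrict_def)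
  then show ?thesis
    unfolding homeomorphic_space_def by blast
qed

lemma compact_space_dict_space: "compact_space (dict_space n)"
  using homeomorphic_compact_space[OF dict_space_homeomorphic_product]
  by (simp add: compact_space_product_topology compact_space_discrete_topology)

lemma completely_metrizable_dict_space: "completely_metrizable_space (dict_space n)"
proof -
  have "countable {w \<in> words n. \<not> (\<exists>a. topspace (discrete_topology (UNIV :: bool set)) \<subseteq> {a})}"
    by (rule countable_subset[OF _ countable_words]) auto
  then show ?thesis
    using homeomorphic_completely_metrizable_space[OF dict_space_homeomorphic_product]
    by (simp add: completely_metrizable_space_product_topology
        completely_metrizable_space_discrete_topology)
qed

lemma Hausdorff_dict_space: "Hausdorff_space (dict_space n)"
  by (simp add: completely_metrizable_dict_space completely_metrizable_imp_metrizable_space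
      metrizable_imp_Hausdorff_space)

lemma dict_space_agree_nhd:
  assumes "finite F" "F \<subseteq> words n"
  shows "openin (dict_space n) {A'. A' \<subseteq> words n \<and> A' \<inter> F = A \<inter> F}"
    and "closedin (dict_space n) {A'. A' \<subseteq> words n \<and> A' \<inter> F = A \<inter> F}"
  using assms unfolding closedin_def openin_dict_space
  by (auto intro!: exI[of _ F])

text \<open>
  This one set has two uses: it witnesses separability here, and later it is the \<open>F\<^sub>\<sigma>\<close> set that is
  not \<open>G\<^sub>\<delta>\<close>.
\<close>

definition finite_dictionaries :: "nat \<Rightarrow> nat list set set"
  where "finite_dictionaries n = {A. finite A \<and> A \<subseteq> words n}"

lemma countable_finite_dictionaries: "countable (finite_dictionaries n)"
  unfolding finite_dictionaries_def
  by (intro countable_Collect_finite_subset countable_words)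

lemma closure_of_finite_dictionaries:
  "dict_space n closure_of finite_dictionaries n = topspace (dict_space n)"
proof -
  have "\<exists>B\<in>finite_dictionaries n. B \<in> U" if "openin (dict_space n) U" "A \<in> U" for A U
  proof -
    obtain F where F: "finite F" "F \<subseteq> words n"
        "\<forall>A'\<subseteq>words n. A' \<inter> F = A \<inter> F \<longrightarrow> A' \<in> U"
      by (rule openin_dict_spaceE[OF \<open>openin (dict_space n) U\<close> \<open>A \<in> U\<close>])
    have "A \<inter> F \<in> U"
      using F(2) by (intro F(3)[rule_format]) auto
    moreover have "A \<inter> F \<in> finite_dictionaries n"
      using F(1,2) by (auto simp: finite_dictionaries_def)
    ultimately show ?thesis
      by blast
  qed
  then show ?thesis
    by (auto simp: closure_of_def)
qed

lemma zero_dim_polish_dict_space: "zero_dim_polish (dict_space n)"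
proof -
  have "separable_space (dict_space n)"
    unfolding separable_space_def
    using countable_finite_dictionaries closure_of_finite_dictionaries
    by (intro exI[of _ "finite_dictionaries n"]) (auto simp: finite_dictionaries_def)
  moreover have "\<exists>V. openin (dict_space n) V \<and> closedin (dict_space n) V \<and> A \<in> V \<and> V \<subseteq> U"
    if U: "openin (dict_space n) U" "A \<in> U" for U A
  proof -
    obtain F where F: "finite F" "F \<subseteq> words n"
        "\<forall>A'\<subseteq>words n. A' \<inter> F = A \<inter> F \<longrightarrow> A' \<in> U"
      by (rule openin_dict_spaceE[OF U])
    let ?V = "{A'. A' \<subseteq> words n \<and> A' \<inter> F = A \<inter> F}"
    have "A \<in> ?V"
      using openin_subset[OF that(1)] that(2) by auto
    moreover have "?V \<subseteq> U"
      using F(3) by blast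
    ultimately show ?thesis
      using dict_space_agree_nhd[OF F(1,2)] by blast
  qed
  ultimately show ?thesis
    unfolding zero_dim_polish_def using completely_metrizable_dict_space by blast
qed

lemma continuous_map_into_dict_space:
  assumes "\<And>y. y \<in> topspace Y \<Longrightarrow> f y \<subseteq> words n"
    and clopen: "\<And>w. w \<in> words n \<Longrightarrow> openin Y {y \<in> topspace Y. w \<in> f y}"
      "\<And>w. w \<in> words n \<Longrightarrow> closedin Y {y \<in> topspace Y. w \<in> f y}"
  shows "continuous_map Y (dict_space n) f"
  unfolding continuous_map_def
proof (intro conjI allI impI)
  fix U assume U: "openin (dict_space n) U"
  show "openin Y {y \<in> topspace Y. f y \<in> U}"
  proof (subst openin_subopen, intro ballI)
    fix y assume y: "y \<in> {y \<in> topspace Y. f y \<in> U}"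
    then have "f y \<in> U"
      by simp
    obtain F where F: "finite F" "F \<subseteq> words n"
        "\<forall>A'\<subseteq>words n. A' \<inter> F = f y \<inter> F \<longrightarrow> A' \<in> U"
      by (rule openin_dict_spaceE[OF U \<open>f y \<in> U\<close>])
    define T where "T = topspace Y \<inter> (\<Inter>w\<in>F. {y' \<in> topspace Y. w \<in> f y' \<longleftrightarrow> w \<in> f y})"
    have "openin Y {y' \<in> topspace Y. w \<in> f y' \<longleftrightarrow> w \<in> f y}" if "w \<in> F" for w
    proof (cases "w \<in> f y")
      case False
      then have "{y' \<in> topspace Y. w \<in> f y' \<longleftrightarrow> w \<in> f y}
          = topspace Y - {y \<in> topspace Y. w \<in> f y}"
        by auto
      then show ?thesis
        using clopen(2) F(2) that by auto
    qed (use clopen(1) F(2) that in auto)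
    then have "openin Y T"
      unfolding T_def using F(1) by (cases "F = {}") (auto intro!: openin_Int openin_Inter)
    moreover have "f y' \<in> U" if "y' \<in> T" for y'
      using that assms(1) by (intro F(3)[rule_format]) (auto simp: T_def)
    ultimately show "\<exists>T. openin Y T \<and> y \<in> T \<and> T \<subseteq> {y \<in> topspace Y. f y \<in> U}"
      using y by (intro exI[of _ T]) (auto simp: T_def)
  qed
qed (use assms(1) in auto)

section \<open>The space of infinite words\<close>

lemma compact_space_omega_space: "compact_space (omega_space n)"
  by (simp add: omega_space_def compact_space_product_topology compact_space_discrete_topology)

lemma openin_omega_space:
  "openin (omega_space n) U \<longleftrightarrow>
    U \<subseteq> topspace (omega_space n) \<and>
    (\<forall>x\<in>U. \<exists>N. \<forall>y\<in>topspace (omega_space n). prefix N y = prefix N x \<longrightarrow> y \<in> U)"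
  (is "?lhs \<longleftrightarrow> ?rhs")
proof
  assume L: ?lhs
  show ?rhs
  proof (intro conjI ballI)
    fix x assume "x \<in> U"
    then obtain W where W: "finite {i. W i \<noteq> {..<n}}" "x \<in> Pi\<^sub>E UNIV W" "Pi\<^sub>E UNIV W \<subseteq> U"
      using L unfolding omega_space_def openin_product_topology_alt by auto
    obtain N where N: "\<And>i. W i \<noteq> {..<n} \<Longrightarrow> i < N"
      using finite_nat_bounded[OF W(1)] by auto
    have "y \<in> U" if y: "y \<in> topspace (omega_space n)" "prefix N y = prefix N x" for y
    proof -
      have "y i \<in> W i" for i
      proof (cases "W i = {..<n}")
        case False
        then have "y i = x i"
          using N[OF False] y(2) by (metis add_0 diff_zero subsequence_nth)
        then show ?thesis using W(2) by (auto simp: PiE_iff)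
      qed (use y(1) in \<open>auto simp: topspace_omega_space\<close>)
      then show ?thesis using W(3) by (auto simp: PiE_iff)
    qed
    then show "\<exists>N. \<forall>y\<in>topspace (omega_space n). prefix N y = prefix N x \<longrightarrow> y \<in> U"
      by blast
  qed (use L openin_subset in blast)
next
  assume R: ?rhs
  show ?lhs
    unfolding omega_space_def openin_product_topology_alt
  proof
    fix x assume x: "x \<in> U"
    then obtain N where N: "\<And>y. y \<in> topspace (omega_space n) \<Longrightarrow> prefix N y = prefix N x \<Longrightarrow> y \<in> U"
      using R by blast
    have lt: "x i < n" for i
      using R x by (auto simp: topspace_omega_space)
    define W where "W i = (if i < N then {x i} else {..<n})" for i
    have "finite {i. W i \<noteq> {..<n}}"
      by (rule finite_subset[of _ "{..<N}"]) (auto simp: W_def)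
    moreover have "Pi\<^sub>E UNIV W \<subseteq> U"
    proof
      fix y assume y: "y \<in> Pi\<^sub>E UNIV W"
      then have *: "y i \<in> W i" for i by (auto simp: PiE_iff)
      have "y i = x i" if "i < N" for i
        using *[of i] that by (simp add: W_def)
      moreover have "y i < n" for i
        using *[of i] lt[of i] by (auto simp: W_def split: if_splits)
      ultimately show "y \<in> U"
        by (intro N) (auto simp: topspace_omega_space subsequence_def)
    qed
    ultimately show "\<exists>W. finite {i \<in> UNIV. W i \<noteq> topspace (discrete_topology {..<n})} \<and>
        (\<forall>i\<in>UNIV. openin (discrete_topology {..<n}) (W i)) \<and> x \<in> Pi\<^sub>E UNIV W \<and> Pi\<^sub>E UNIV W \<subseteq> U"
      using lt by (intro exI[of _ W]) (auto simp: W_def)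
  qed
qed

definition cylinder :: "nat \<Rightarrow> nat list \<Rightarrow> (nat \<Rightarrow> nat) set"
  where "cylinder n u = {x \<in> topspace (omega_space n). prefix (length u) x = u}"

lemma prefix_eq_mono:
  assumes "prefix N x = prefix N y" "M \<le> N"
  shows "prefix M x = prefix M y"
  using arg_cong[OF assms(1), of "take M"] assms(2) by (simp add: min_def)

lemma conc_in_cylinder: "u \<frown> z \<in> topspace (omega_space n) \<Longrightarrow> u \<frown> z \<in> cylinder n u"
  by (simp add: cylinder_def)

lemma cylinder_iff: "x \<in> cylinder n u \<longleftrightarrow> x \<in> topspace (omega_space n) \<and> (\<exists>z. x = u \<frown> z)"
  unfolding cylinder_def by (auto, metis prefix_suffix)

lemma clopen_cylinder:
  "openin (omega_space n) (cylinder n u)" "closedin (omega_space n) (cylinder n u)"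
  unfolding closedin_def openin_omega_space
  by (auto simp: cylinder_def intro!: exI[of _ "length u"])

lemma openin_conc_image:
  assumes "openin (omega_space n) U" "w \<in> words n"
  shows "openin (omega_space n) ((\<frown>) w ` U)"
  unfolding openin_omega_space
proof (intro conjI ballI)
  have U: "U \<subseteq> topspace (omega_space n)"
    using assms(1) by (rule openin_subset)
  then show "(\<frown>) w ` U \<subseteq> topspace (omega_space n)"
    using assms(2) by auto
  fix x assume "x \<in> (\<frown>) w ` U"
  then obtain z where z: "z \<in> U" "x = w \<frown> z" by blast
  then obtain N where N: "\<And>y. y \<in> topspace (omega_space n) \<Longrightarrow> prefix N y = prefix N z \<Longrightarrow> y \<in> U"
    using assms(1) unfolding openin_omega_space by blast
  have "y \<in> (\<frown>) w ` U"
    if y: "y \<in> topspace (omega_space n)" "prefix (length w + N) y = prefix (length w + N) x" for y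
  proof -
    have "prefix (length w) y = w"
      using prefix_eq_mono[OF y(2), of "length w"] z by simp
    then have yw: "y = w \<frown> suffix (length w) y"
      by (metis prefix_suffix)
    then have "prefix (length w + N) y = w @ prefix N (suffix (length w) y)"
      by (metis add_diff_cancel_left' le_add1 prefix_conc_snd)
    then have "prefix N (suffix (length w) y) = prefix N z"
      using y(2) z by simp
    moreover have "suffix (length w) y \<in> topspace (omega_space n)"
      using yw y(1) by (metis conc_in_omega_space)
    ultimately show ?thesis
      using N yw by blast
  qed
  then show "\<exists>N. \<forall>y\<in>topspace (omega_space n). prefix N y = prefix N x \<longrightarrow> y \<in> (\<frown>) w ` U"
    by blast
qed

section \<open>Dictionaries with clopen \<open>\<omega>\<close>-power\<close>

text \<open>
  The sets \<open>w C\<close> with \<open>w \<in> A\<close> nonempty are open and cover the compact set \<open>C = A\<^sup>\<infinity>\<close>, so finitely many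
  words \<open>B\<close> satisfy \<open>C \<subseteq> (\<Union>w\<in>B. w C)\<close>.  This is the hypothesis of coinduction for \<open>B\<close>.
\<close>

lemma finite_generators:
  assumes "A \<subseteq> words n"
    and op: "openin (omega_space n) (omega_power n A)"
    and cl: "closedin (omega_space n) (omega_power n A)"
  obtains B where "finite B" "B \<subseteq> A" "omega_power n B = omega_power n A"
proof -
  let ?C = "omega_power n A"
  let ?f = "\<lambda>w. (\<frown>) w ` ?C"
  have "compactin (omega_space n) ?C"
    by (rule closedin_compact_space[OF compact_space_omega_space cl])
  moreover have "\<forall>U\<in>?f ` (A - {[]}). openin (omega_space n) U"
    using assms(1) openin_conc_image[OF op] by auto
  moreover have "?C \<subseteq> \<Union>(?f ` (A - {[]}))"
  proof
    fix x assume "x \<in> ?C"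
    then show "x \<in> \<Union>(?f ` (A - {[]}))"
      by (rule omega_power_unfold) auto
  qed
  ultimately obtain \<F> where \<F>: "finite \<F>" "\<F> \<subseteq> ?f ` (A - {[]})" "?C \<subseteq> \<Union>\<F>"
    unfolding compactin_def by meson
  then obtain B where B: "B \<subseteq> A - {[]}" "finite B" "\<F> = ?f ` B"
    using finite_subset_image by metis
  have "?C \<subseteq> omega_power n B"
  proof
    fix x assume "x \<in> ?C"
    show "x \<in> omega_power n B"
    proof (rule omega_power_coinduct[OF omega_power_subset_topspace \<open>x \<in> ?C\<close>])
      fix x assume "x \<in> ?C"
      then show "\<exists>w\<in>B. w \<noteq> [] \<and> (\<exists>z\<in>?C. x = w \<frown> z)"
        using \<F>(3) B by blast
    qed
  qed
  moreover have "omega_power n B \<subseteq> ?C"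
    using B by (intro omega_power_mono) auto
  ultimately show thesis
    using that B by blast
qed

text \<open>
  Every point of \<open>A\<^sup>\<infinity>\<close> is a limit of points \<open>a\<^sub>0 \<dots> a\<^sub>k y\<close> with \<open>y \<in> C\<close>, and these lie in \<open>C\<close>.
\<close>

lemma omega_power_subset_closed:
  assumes cl: "closedin (omega_space n) C" and "C \<noteq> {}"
    and inv: "\<And>w z. w \<in> A \<Longrightarrow> z \<in> C \<Longrightarrow> w \<frown> z \<in> C"
  shows "omega_power n A \<subseteq> C"
proof
  fix x assume x: "x \<in> omega_power n A"
  have approx: "\<exists>y\<in>C. prefix N y = prefix N x" if "x \<in> omega_power n A" for N x
    using that
  proof (induction N arbitrary: x)
    case 0
    then show ?case using \<open>C \<noteq> {}\<close> by auto
  next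
    case (Suc N)
    from Suc.prems obtain w z where w: "w \<in> A" "w \<noteq> []" "z \<in> omega_power n A" "x = w \<frown> z"
      by (rule omega_power_unfold)
    obtain y where y: "y \<in> C" "prefix N y = prefix N z"
      using Suc.IH w(3) by blast
    have "prefix (length w + N) (w \<frown> y) = prefix (length w + N) x"
      using y(2) w(4) by simp
    moreover have "Suc N \<le> length w + N"
      using w(2) by (cases w) auto
    ultimately have "prefix (Suc N) (w \<frown> y) = prefix (Suc N) x"
      by (rule prefix_eq_mono)
    then show ?case
      using inv w(1) y(1) by blast
  qed
  show "x \<in> C"
  proof (rule ccontr)
    assume "x \<notin> C"
    then have "x \<in> topspace (omega_space n) - C"
      using x omega_power_subset_topspace by blast
    moreover have "openin (omega_space n) (topspace (omega_space n) - C)"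
      using cl by blast
    ultimately obtain N where "\<forall>y\<in>topspace (omega_space n). prefix N y = prefix N x
        \<longrightarrow> y \<in> topspace (omega_space n) - C"
      unfolding openin_omega_space by blast
    then show False
      using approx[OF x, of N] closedin_subset[OF cl] by blast
  qed
qed

text \<open>
  Write \<open>C = B\<^sup>\<infinity>\<close>.  If \<open>B \<subseteq> A\<close> and \<open>A\<^sup>\<infinity> \<noteq> C\<close>, some word \<open>w \<in> A\<close> cannot belong to any dictionary with
  power \<open>C\<close>: otherwise \<open>w C \<subseteq> C\<close> for all \<open>w \<in> A\<close>, and, as \<open>C\<close> is closed, \<open>A\<^sup>\<infinity> \<subseteq> C\<close>.  The empty
  \<open>C\<close> is treated separately, since invariance says nothing about it.
\<close>

lemma closedin_same_omega_power:
  assumes "finite B" "B \<subseteq> words n" and cl: "closedin (omega_space n) (omega_power n B)"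
  shows "closedin (dict_space n) {A. A \<subseteq> words n \<and> B \<subseteq> A \<and> omega_power n A = omega_power n B}"
    (is "closedin _ ?S")
proof -
  let ?C = "omega_power n B"
  have "\<exists>F. finite F \<and> F \<subseteq> words n \<and>
      (\<forall>A'\<subseteq>words n. A' \<inter> F = A \<inter> F \<longrightarrow> A' \<in> Pow (words n) - ?S)"
    if A: "A \<subseteq> words n" "A \<notin> ?S" for A
  proof (cases "B \<subseteq> A")
    case False
    then show ?thesis
      using assms(1,2) by (intro exI[of _ B]) auto
  next
    case True
    have "\<exists>w\<in>A. \<forall>A'\<subseteq>words n. w \<in> A' \<longrightarrow> omega_power n A' \<noteq> ?C"
    proof (rule ccontr)
      assume "\<not> ?thesis"
      then have *: "\<exists>A'\<subseteq>words n. w \<in> A' \<and> omega_power n A' = ?C" if "w \<in> A" for w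
        using that by blast
      have "omega_power n A = ?C"
      proof (cases "?C = {}")
        case True
        have "w = []" if w: "w \<in> A" for w
        proof -
          obtain A' where "A' \<subseteq> words n" "w \<in> A'" "omega_power n A' = ?C"
            using *[OF w] by blast
          then show ?thesis
            using omega_power_eq_empty_iff[of A' n] True by auto
        qed
        then have "A \<subseteq> {[]}" by blast
        with A(1) True show ?thesis
          by (simp add: omega_power_eq_empty_iff)
      next
        case False
        have "w \<frown> z \<in> ?C" if "w \<in> A" "z \<in> ?C" for w z
          using *[OF that(1)] that(2) omega_power_conc by metis
        then have "omega_power n A \<subseteq> ?C"
          by (intro omega_power_subset_closed[OF cl False])
        with omega_power_mono[OF \<open>B \<subseteq> A\<close>] show ?thesis by blast
      qed
      with A True show False by blast
    qed
    then obtain w where w: "w \<in> A" "\<And>A'. A' \<subseteq> words n \<Longrightarrow> w \<in> A' \<Longrightarrow> omega_power n A' \<noteq> ?C"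
      by blast
    have "A' \<in> Pow (words n) - ?S" if "A' \<subseteq> words n" "A' \<inter> {w} = A \<inter> {w}" for A'
    proof -
      have "w \<in> A'" using that(2) w(1) by blast
      then show ?thesis using w(2) that(1) by simp
    qed
    then show ?thesis
      using w(1) A(1) by (intro exI[of _ "{w}"]) auto
  qed
  then show ?thesis
    unfolding closedin_def openin_dict_space topspace_dict_space by auto
qed

text \<open>
  By \<open>finite_generators\<close> every dictionary with clopen power lies in the piece of some finite \<open>B\<close>.
\<close>

lemma clopen_powers_countable_Union_closed:
  obtains \<K> where "countable \<K>" "\<And>K. K \<in> \<K> \<Longrightarrow> closedin (dict_space n) K"
    "\<Union>\<K> = {A. A \<subseteq> words n \<and> openin (omega_space n) (omega_power n A) \<and>
      closedin (omega_space n) (omega_power n A)}"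
proof
  let ?S = "{A. A \<subseteq> words n \<and> openin (omega_space n) (omega_power n A) \<and>
      closedin (omega_space n) (omega_power n A)}"
  let ?\<B> = "{B \<in> finite_dictionaries n. openin (omega_space n) (omega_power n B) \<and>
      closedin (omega_space n) (omega_power n B)}"
  let ?K = "\<lambda>B. {A. A \<subseteq> words n \<and> B \<subseteq> A \<and> omega_power n A = omega_power n B}"
  show "countable (?K ` ?\<B>)"
    by (intro countable_image countable_subset[OF _ countable_finite_dictionaries]) auto
  show "closedin (dict_space n) K" if "K \<in> ?K ` ?\<B>" for K
    using that closedin_same_omega_power unfolding finite_dictionaries_def by blast
  show "\<Union>(?K ` ?\<B>) = ?S"
  proof
    show "?S \<subseteq> \<Union>(?K ` ?\<B>)"
    proof
      fix A assume A: "A \<in> ?S"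
      then obtain B where "finite B" "B \<subseteq> A" "omega_power n B = omega_power n A"
        using finite_generators by blast
      with A have "B \<in> ?\<B>" "A \<in> ?K B"
        by (auto simp: finite_dictionaries_def)
      then show "A \<in> \<Union>(?K ` ?\<B>)" by blast
    qed
  qed auto
qed

lemma openin_full_power:
  "openin (dict_space n) {A. A \<subseteq> words n \<and> omega_power n A = topspace (omega_space n)}"
  unfolding openin_dict_space
proof (intro conjI ballI)
  fix A assume "A \<in> {A. A \<subseteq> words n \<and> omega_power n A = topspace (omega_space n)}"
  then have A: "A \<subseteq> words n" "omega_power n A = topspace (omega_space n)" by auto
  have "openin (omega_space n) (omega_power n A)" "closedin (omega_space n) (omega_power n A)"
    unfolding A(2) by auto
  from finite_generators[OF A(1) this] obtain B
    where B: "finite B" "B \<subseteq> A" "omega_power n B = topspace (omega_space n)"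
    using A(2) by metis
  have "omega_power n A' = topspace (omega_space n)" if "A' \<inter> B = A \<inter> B" for A'
  proof -
    have "B \<subseteq> A'" using that B(2) by blast
    then show ?thesis
      using omega_power_mono[of B A' n] B(3) omega_power_subset_topspace[of n A'] by auto
  qed
  then show "\<exists>F. finite F \<and> F \<subseteq> words n \<and> (\<forall>A'\<subseteq>words n. A' \<inter> F = A \<inter> F \<longrightarrow>
      A' \<in> {A. A \<subseteq> words n \<and> omega_power n A = topspace (omega_space n)})"
    using B A(1) by (intro exI[of _ B]) auto
qed auto

lemma prefix_in_words: "x \<in> topspace (omega_space n) \<Longrightarrow> prefix N x \<in> words n"
  by (metis conc_in_omega_space prefix_suffix)

lemma suffix_in_omega_space:
  "x \<in> topspace (omega_space n) \<Longrightarrow> suffix N x \<in> topspace (omega_space n)"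
  by (metis conc_in_omega_space prefix_suffix)

text \<open>
  Cut an infinite word into blocks of length \<open>N + 1\<close>.
\<close>

lemma omega_power_full_length:
  assumes "\<And>w. w \<in> words n \<Longrightarrow> length w = Suc N \<Longrightarrow> w \<in> A"
  shows "omega_power n A = topspace (omega_space n)"
proof
  show "topspace (omega_space n) \<subseteq> omega_power n A"
  proof
    fix x assume "x \<in> topspace (omega_space n)"
    then show "x \<in> omega_power n A"
    proof (rule omega_power_coinduct[OF subset_refl])
      fix x assume x: "x \<in> topspace (omega_space n)"
      then have "prefix (Suc N) x \<in> A"
        using assms prefix_in_words by (simp del: subseq_to_Suc)
      moreover have "prefix (Suc N) x \<noteq> []"
        by simp
      moreover have "x = prefix (Suc N) x \<frown> suffix (Suc N) x"
        by (rule prefix_suffix)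
      ultimately show "\<exists>w\<in>A. w \<noteq> [] \<and> (\<exists>z\<in>topspace (omega_space n). x = w \<frown> z)"
        using suffix_in_omega_space[OF x] by blast
    qed
  qed
qed (rule omega_power_subset_topspace)

text \<open>
  A basic neighbourhood constrains finitely many words, so all words of one length above theirs can be
  added without leaving it.
\<close>

lemma dense_full_power:
  "dict_space n closure_of {A. A \<subseteq> words n \<and> omega_power n A = topspace (omega_space n)}
    = topspace (dict_space n)" (is "_ closure_of ?S = _")
proof -
  have "\<exists>B\<in>?S. B \<in> U" if U: "openin (dict_space n) U" "A \<in> U" for A U
  proof -
    obtain F where F: "finite F" "F \<subseteq> words n"
        "\<forall>A'\<subseteq>words n. A' \<inter> F = A \<inter> F \<longrightarrow> A' \<in> U"
      by (rule openin_dict_spaceE[OF U])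
    have "finite (length ` F)"
      using F(1) by simp
    then obtain N where N: "\<And>w. w \<in> F \<Longrightarrow> length w < N"
      by (meson finite_nat_set_iff_bounded image_eqI)
    define B where "B = A \<union> {w \<in> words n. length w = Suc N}"
    have "A \<subseteq> words n"
      using openin_subset[OF U(1)] U(2) by auto
    then have "B \<subseteq> words n"
      by (auto simp: B_def)
    moreover have "B \<inter> F = A \<inter> F"
      using N by (force simp: B_def)
    moreover have "omega_power n B = topspace (omega_space n)"
      by (rule omega_power_full_length[of _ N]) (simp add: B_def)
    ultimately show ?thesis
      using F(3) by blast
  qed
  then show ?thesis
    unfolding closure_of_def by auto
qed

section \<open>Reductions from zero-dimensional Polish spaces\<close>

lemma separable_metrizable_imp_second_countable:
  assumes "metrizable_space X" "separable_space X"
  shows "second_countable X"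
proof -
  obtain M d where "Metric_space M d" and X: "X = Metric_space.mtopology M d"
    using assms(1) unfolding metrizable_space_def by blast
  then interpret Metric_space M d by simp
  obtain C where C: "countable C" "C \<subseteq> M" "mtopology closure_of C = M"
    using assms(2) unfolding separable_space_def X by auto
  let ?b = "\<lambda>(c, k::nat). mball c (inverse (Suc k))"
  have "\<exists>V\<in>?b ` (C \<times> UNIV). x \<in> V \<and> V \<subseteq> U" if U: "openin mtopology U" "x \<in> U" for U x
  proof -
    obtain r where r: "r > 0" "mball x r \<subseteq> U"
      using U unfolding openin_mtopology by blast
    have "x \<in> M"
      using U unfolding openin_mtopology by blast
    obtain k where k: "inverse (real (Suc k)) < r / 2"
      using reals_Archimedean[of "r / 2"] r(1) by auto
    have "x \<in> mtopology closure_of C"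
      using C(3) \<open>x \<in> M\<close> by simp
    moreover have "0 < inverse (real (Suc k))"
      by simp
    ultimately obtain c where c: "c \<in> C" "c \<in> mball x (inverse (real (Suc k)))"
      unfolding metric_closure_of by blast
    have "mball c (inverse (real (Suc k))) \<subseteq> mball x r"
      using c(2) k by (intro mball_subset) (auto simp: commute)
    moreover have "x \<in> mball c (inverse (real (Suc k)))"
      using c(2) by (auto simp: commute)
    ultimately show ?thesis
      using c(1) r(2) by (intro bexI[of _ "?b (c, k)"]) auto
  qed
  moreover have "countable (?b ` (C \<times> UNIV))"
    using C(1) by (intro countable_image countable_SIGMA) auto
  ultimately show ?thesis
    unfolding second_countable_def X by (intro exI[of _ "?b ` (C \<times> UNIV)"]) auto
qed

text \<open>
  For each set \<open>B\<close> of a countable base that is contained in some clopen subset of \<open>W\<close>, one such clopen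
  set is chosen.
\<close>

lemma zero_dim_polish_open_is_clopen_Union:
  assumes "zero_dim_polish Y" "openin Y W"
  obtains V :: "nat \<Rightarrow> 'b set"
  where "\<And>i. openin Y (V i)" "\<And>i. closedin Y (V i)" "W = (\<Union>i. V i)"
proof -
  have "second_countable Y"
    using assms(1) unfolding zero_dim_polish_def
    by (simp add: completely_metrizable_imp_metrizable_space separable_metrizable_imp_second_countable)
  then obtain \<B> where \<B>: "countable \<B>"
      "\<forall>U x. openin Y U \<and> x \<in> U \<longrightarrow> (\<exists>V\<in>\<B>. x \<in> V \<and> V \<subseteq> U)"
    unfolding second_countable_def by (elim exE conjE)
  let ?P = "\<lambda>B V. openin Y V \<and> closedin Y V \<and> B \<subseteq> V \<and> V \<subseteq> W"
  let ?\<B> = "{B \<in> \<B>. \<exists>V. ?P B V}"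
  have "\<forall>B\<in>?\<B>. \<exists>V. ?P B V"
    by simp
  then obtain v where v: "\<forall>B\<in>?\<B>. ?P B (v B)"
    by (rule bchoice[THEN exE])
  \<comment> \<open>the empty set is added because an enumeration by all natural numbers needs a member\<close>
  define \<V> where "\<V> = insert {} (v ` ?\<B>)"
  have "countable \<V>"
    using \<B>(1) by (auto simp: \<V>_def intro: countable_subset)
  then have V: "range (from_nat_into \<V>) = \<V>"
    by (intro range_from_nat_into) (auto simp: \<V>_def)
  have clopen: "openin Y S \<and> closedin Y S \<and> S \<subseteq> W" if "S \<in> \<V>" for S
    using that v by (auto simp: \<V>_def)
  have "W \<subseteq> \<Union>\<V>"
  proof
    fix x assume "x \<in> W"
    then obtain T where T: "openin Y T" "closedin Y T" "x \<in> T" "T \<subseteq> W"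
      using assms unfolding zero_dim_polish_def by blast
    then obtain B where B: "B \<in> \<B>" "x \<in> B" "B \<subseteq> T"
      using \<B>(2) by blast
    then have "B \<in> ?\<B>"
      using T by blast
    then have "v B \<in> \<V>" "x \<in> v B"
      using bspec[OF v, of B] B(2) by (auto simp: \<V>_def)
    then show "x \<in> \<Union>\<V>" by blast
  qed
  then have "W = \<Union>\<V>"
    using clopen by blast
  then have "W = (\<Union>i. from_nat_into \<V> i)"
    unfolding V .
  moreover have "from_nat_into \<V> i \<in> \<V>" for i
    by (rule from_nat_into) (simp add: \<V>_def)
  ultimately show thesis
    using that[of "from_nat_into \<V>"] clopen by simp
qed

text \<open>
  Words of length \<open>i + 1\<close>, rather than \<open>i\<close>, are controlled by the \<open>i\<close>-th clopen set so that no word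
  involved is empty.
\<close>

lemma open_set_reduction:
  fixes Y :: "'b topology"
  assumes "zero_dim_polish Y" "openin Y W" "n \<ge> 1"
  obtains f where "continuous_map Y (dict_space n) f"
    "\<And>y. y \<in> W \<Longrightarrow> omega_power n (f y) = topspace (omega_space n)"
    "\<And>y. y \<notin> W \<Longrightarrow> omega_power n (f y) = {}"
proof -
  obtain V :: "nat \<Rightarrow> 'b set" where V: "\<And>i. openin Y (V i)" "\<And>i. closedin Y (V i)" "W = (\<Union>i. V i)"
    using zero_dim_polish_open_is_clopen_Union[OF assms(1,2)] by metis
  define f where "f y = {w \<in> words n. w \<noteq> [] \<and> y \<in> V (length w - 1)}" for y
  have eq: "{y \<in> topspace Y. w \<in> f y} = (if w \<in> words n \<and> w \<noteq> [] then V (length w - 1) else {})" for w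
    using openin_subset[OF V(1)] by (auto simp: f_def)
  have "continuous_map Y (dict_space n) f"
    by (rule continuous_map_into_dict_space; (unfold eq)?) (simp_all add: V f_def)
  moreover have "omega_power n (f y) = topspace (omega_space n)" if y: "y \<in> W" for y
  proof -
    obtain i where "y \<in> V i"
      using y V(3) by blast
    then show ?thesis
      by (intro omega_power_full_length[of _ i]) (auto simp: f_def)
  qed
  moreover have "omega_power n (f y) = {}" if "y \<notin> W" for y
    using that V(3) by (subst omega_power_eq_empty_iff) (auto simp: f_def)
  ultimately show thesis
    using that by blast
qed

text \<open>
  Write \<open>D\<close> as an increasing union of closed sets \<open>F m\<close>, and the complement of \<open>F m\<close> as a union of clopen
  sets \<open>V m j\<close>.  Each \<open>m\<close> with \<open>y \<notin> F m\<close> puts one number into \<open>K y\<close>, namely the code of \<open>(m, j)\<close> for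
  the least \<open>j\<close> with \<open>y \<in> V m j\<close>.  Recording \<open>m\<close> alone would make the dependence on \<open>y\<close> merely open;
  recording the least \<open>j\<close> as well makes it clopen.  Since \<open>F\<close> is increasing, \<open>K y\<close> is finite exactly
  when \<open>y\<close> is in some \<open>F m\<close>.
\<close>

lemma fsigma_finite_reduction:
  assumes "zero_dim_polish Y" "fsigma_in Y D"
  obtains K :: "'b \<Rightarrow> nat set"
  where "\<And>k. openin Y {y \<in> topspace Y. k \<in> K y}" "\<And>k. closedin Y {y \<in> topspace Y. k \<in> K y}"
    "\<And>y. y \<in> topspace Y \<Longrightarrow> finite (K y) \<longleftrightarrow> y \<in> D"
proof -
  obtain F :: "nat \<Rightarrow> 'b set" where F: "\<And>m. closedin Y (F m)" "\<And>m. F m \<subseteq> F (Suc m)" "\<Union>(range F) = D"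
    using assms(2) unfolding fsigma_in_ascending by blast
  have "\<exists>V. (\<forall>j::nat. openin Y (V j) \<and> closedin Y (V j)) \<and> topspace Y - F m = (\<Union>j. V j)" for m
  proof -
    have "openin Y (topspace Y - F m)"
      using F(1) by blast
    then show ?thesis
      by (rule zero_dim_polish_open_is_clopen_Union[OF assms(1)]) (intro exI conjI allI)
  qed
  then obtain V :: "nat \<Rightarrow> nat \<Rightarrow> 'b set"
    where "\<forall>m. (\<forall>j. openin Y (V m j) \<and> closedin Y (V m j)) \<and> topspace Y - F m = (\<Union>j. V m j)"
    by (rule choice[OF allI, THEN exE])
  then have V: "openin Y (V m j)" "closedin Y (V m j)" "topspace Y - F m = (\<Union>j. V m j)" for m j
    by simp_all
  define J where "J y m = (LEAST j. y \<in> V m j)" for y m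
  define K where "K y = (\<lambda>m. prod_encode (m, J y m)) ` {m. y \<in> topspace Y - F m}" for y
  have K_iff: "{y \<in> topspace Y. prod_encode (m, j) \<in> K y} = V m j - (\<Union>i<j. V m i)" for m j
  proof -
    have "prod_encode (m, j) \<in> K y \<longleftrightarrow> y \<in> V m j - (\<Union>i<j. V m i)" for y
    proof
      assume "prod_encode (m, j) \<in> K y"
      then have y: "\<exists>j. y \<in> V m j" and j: "j = J y m"
        using V(3) by (auto simp: K_def)
      have "y \<in> V m j"
        unfolding j J_def using y by (rule LeastI_ex)
      moreover have "y \<notin> V m i" if "i < j" for i
        using that not_less_Least unfolding j J_def by blast
      ultimately show "y \<in> V m j - (\<Union>i<j. V m i)" by blast
    next
      assume y: "y \<in> V m j - (\<Union>i<j. V m i)"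
      then have "J y m = j"
        unfolding J_def by (intro Least_equality) (auto simp: not_less[symmetric])
      moreover have "y \<in> topspace Y - F m"
        using y V(3) by blast
      ultimately show "prod_encode (m, j) \<in> K y"
        by (auto simp: K_def)
    qed
    moreover have "V m j \<subseteq> topspace Y"
      using V(1) by (rule openin_subset)
    ultimately show ?thesis by blast
  qed
  have "finite (K y) \<longleftrightarrow> y \<in> D" if y: "y \<in> topspace Y" for y
  proof -
    have "inj_on (\<lambda>m. prod_encode (m, J y m)) {m. y \<in> topspace Y - F m}"
      by (auto simp: inj_on_def)
    then have "finite (K y) \<longleftrightarrow> finite {m. y \<notin> F m}"
      unfolding K_def using y by (simp add: finite_image_iff)
    also have "\<dots> \<longleftrightarrow> (\<exists>m. y \<in> F m)"
    proof
      assume "finite {m. y \<notin> F m}"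
      then have "{m. y \<notin> F m} \<noteq> UNIV" by auto
      then show "\<exists>m. y \<in> F m" by blast
    next
      assume "\<exists>m. y \<in> F m"
      then obtain m where "y \<in> F m" ..
      then have "m' < m" if "y \<notin> F m'" for m'
        using that lift_Suc_mono_le[of F m m'] F(2) by (meson in_mono not_le)
      then have "{m. y \<notin> F m} \<subseteq> {..<m}"
        by (simp add: subset_iff)
      then show "finite {m. y \<notin> F m}"
        by (rule finite_subset) simp
    qed
    finally show ?thesis
      using F(3) by blast
  qed
  moreover have "openin Y {y \<in> topspace Y. k \<in> K y} \<and> closedin Y {y \<in> topspace Y. k \<in> K y}" for k
  proof (cases "prod_decode k")
    case (Pair m j)
    then have k: "k = prod_encode (m, j)"
      by (metis prod_decode_inverse)
    have "closedin Y (\<Union>i<j. V m i)" "openin Y (\<Union>i<j. V m i)"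
      using V by (auto intro: closedin_Union openin_Union)
    then show ?thesis
      unfolding k K_iff using V by (auto intro: openin_diff closedin_diff)
  qed
  ultimately show thesis
    using that by blast
qed

section \<open>Dictionaries with clopen power for finite parameters only\<close>

text \<open>
  The first two families of stems cover everything except the words that begin with \<open>01\<close>.  The third family
  adds the cylinder of \<open>0 1\<^sup>k\<^sup>+\<^sup>1 0\<close> for each \<open>k \<in> K\<close>; for infinite \<open>K\<close> these cylinders
  accumulate at \<open>0111\<dots>\<close>, which no stem covers.
\<close>

definition stems :: "nat set \<Rightarrow> nat list set"
  where "stems K = {[i] |i. i \<noteq> 0} \<union> {[0, i] |i. i \<noteq> 1} \<union> (\<lambda>k. 0 # replicate (Suc k) 1 @ [0]) ` K"

definition stem_dictionary :: "nat \<Rightarrow> nat set \<Rightarrow> nat list set"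
  where "stem_dictionary n K = {w \<in> words n. \<exists>u\<in>stems K. \<exists>v. w = u @ v}"

text \<open>
  After a stem \<open>u\<close>, any continuation \<open>z\<close> can be split again: either \<open>z\<close> begins with a stem, or \<open>z\<close> begins
  with \<open>01\<close>, and then \<open>u0\<close> is also in the dictionary and what remains begins with the stem \<open>1\<close>.
\<close>

lemma omega_power_stem_dictionary:
  "omega_power n (stem_dictionary n K) = (\<Union>u\<in>stems K. cylinder n u)"
  (is "_ = ?G")
proof
  show "omega_power n (stem_dictionary n K) \<subseteq> ?G"
  proof
    fix x assume x: "x \<in> omega_power n (stem_dictionary n K)"
    then obtain w z where "w \<in> stem_dictionary n K" "x = w \<frown> z"
      by (rule omega_power_unfold)
    then obtain u v where "u \<in> stems K" "x = u \<frown> v \<frown> z"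
      by (auto simp: stem_dictionary_def)
    moreover have "x \<in> topspace (omega_space n)"
      using x omega_power_subset_topspace by blast
    ultimately show "x \<in> ?G"
      unfolding cylinder_iff UN_iff by blast
  qed
  show "?G \<subseteq> omega_power n (stem_dictionary n K)"
  proof
    fix x assume "x \<in> ?G"
    show "x \<in> omega_power n (stem_dictionary n K)"
    proof (rule omega_power_coinduct[OF _ \<open>x \<in> ?G\<close>])
      show "?G \<subseteq> topspace (omega_space n)"
        by (auto simp: cylinder_def)
      fix x assume "x \<in> ?G"
      then obtain u z where u: "u \<in> stems K" and x: "x \<in> topspace (omega_space n)" "x = u \<frown> z"
        unfolding cylinder_iff UN_iff by blast
      have uz: "u \<in> words n" "z \<in> topspace (omega_space n)"
        using x by auto
      have "u \<noteq> []"
        using u by (auto simp: stems_def)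
      show "\<exists>w\<in>stem_dictionary n K. w \<noteq> [] \<and> (\<exists>z\<in>?G. x = w \<frown> z)"
      proof (cases "z \<in> ?G")
        case True
        moreover have "u \<in> stem_dictionary n K"
          using u uz by (auto simp: stem_dictionary_def)
        ultimately show ?thesis
          using x(2) \<open>u \<noteq> []\<close> by blast
      next
        case False
        have "z \<in> cylinder n (prefix N z)" for N
          using uz(2) by (simp add: cylinder_def)
        then have "prefix 1 z \<notin> stems K" "prefix 2 z \<notin> stems K"
          using False by blast+
        then have "z 0 = 0" "z 1 = 1"
          by (auto simp: stems_def subsequence_def upt_rec)
        let ?w = "u @ prefix 1 z"
        have "?w \<in> stem_dictionary n K"
          using u uz prefix_in_words[OF uz(2), of 1] by (auto simp: stem_dictionary_def words_def)
        moreover have "suffix 1 z \<in> cylinder n [1]"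
          using suffix_in_omega_space[OF uz(2), of 1] \<open>z 1 = 1\<close>
          by (simp add: cylinder_def subsequence_def)
        then have "suffix 1 z \<in> ?G"
          by (rule UN_I[rotated]) (auto simp: stems_def)
        moreover have "x = ?w \<frown> suffix 1 z"
          unfolding x(2) conc_conc[symmetric] prefix_suffix[symmetric] ..
        ultimately show ?thesis
          using \<open>u \<noteq> []\<close> by blast
      qed
    qed
  qed
qed

lemma openin_stem_dictionary_power:
  "openin (omega_space n) (omega_power n (stem_dictionary n K))"
  unfolding omega_power_stem_dictionary using clopen_cylinder by (intro openin_Union) auto

lemma closedin_stem_dictionary_power_iff:
  assumes "n \<ge> 2"
  shows "closedin (omega_space n) (omega_power n (stem_dictionary n K)) \<longleftrightarrow> finite K"
proof
  assume "finite K"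
  let ?U = "stems K \<inter> words n"
  have "?U \<subseteq> (\<lambda>i. [i]) ` {..<n} \<union> (\<lambda>i. [0, i]) ` {..<n} \<union> (\<lambda>k. 0 # replicate (Suc k) 1 @ [0]) ` K"
    by (auto simp: stems_def words_def)
  then have "finite ?U"
    by (rule finite_subset) (simp add: \<open>finite K\<close>)
  moreover have "cylinder n u = {}" if "u \<notin> words n" for u
    using that by (auto simp: cylinder_iff)
  then have "omega_power n (stem_dictionary n K) = (\<Union>u\<in>?U. cylinder n u)"
    unfolding omega_power_stem_dictionary by blast
  ultimately show "closedin (omega_space n) (omega_power n (stem_dictionary n K))"
    using clopen_cylinder by (auto intro: closedin_Union)
next
  let ?G = "omega_power n (stem_dictionary n K)"
  assume cl: "closedin (omega_space n) ?G"
  \<comment> \<open>the point \<open>0111\<dots>\<close>\<close>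
  define x where "x i = (if i = 0 then 0 else 1 :: nat)" for i :: nat
  have "x \<in> topspace (omega_space n)"
    using assms by (auto simp: x_def topspace_omega_space)
  moreover have "x \<notin> cylinder n u" if "u \<in> stems K" for u
  proof
    assume "x \<in> cylinder n u"
    then have "u ! i = x i" if "i < length u" for i
      using that unfolding cylinder_def by (metis (mono_tags, lifting) add_0 diff_zero mem_Collect_eq subsequence_nth)
    moreover have "\<exists>i<length u. u ! i \<noteq> x i"
      using \<open>u \<in> stems K\<close> unfolding stems_def
    proof (elim UnE CollectE exE conjE imageE)
      fix i assume "u = [i]" "i \<noteq> 0"
      then show ?thesis
        by (intro exI[of _ 0]) (simp add: x_def)
    next
      fix i assume "u = [0, i]" "i \<noteq> 1"
      then show ?thesis
        by (intro exI[of _ 1]) (simp add: x_def)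
    next
      fix k assume "u = 0 # replicate (Suc k) 1 @ [0]"
      then show ?thesis
        by (intro exI[of _ "Suc (Suc k)"]) (simp add: x_def nth_append)
    qed
    ultimately show False by blast
  qed
  ultimately have "x \<in> topspace (omega_space n) - ?G"
    unfolding omega_power_stem_dictionary by blast
  moreover have "openin (omega_space n) (topspace (omega_space n) - ?G)"
    using cl by blast
  ultimately obtain N where N: "\<And>y. y \<in> topspace (omega_space n) \<Longrightarrow> prefix N y = prefix N x \<Longrightarrow> y \<notin> ?G"
    unfolding openin_omega_space by blast
  have "k < N" if "k \<in> K" for k
  proof (rule ccontr)
    assume "\<not> k < N"
    let ?u = "0 # replicate (Suc k) 1 @ [0 :: nat]"
    let ?y = "?u \<frown> (\<lambda>_. 0)"
    have "?u \<in> words n" "(\<lambda>_. 0) \<in> topspace (omega_space n)"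
      using assms by (auto simp: words_def topspace_omega_space)
    then have "?y \<in> topspace (omega_space n)"
      by (simp del: build_cons build_append)
    moreover have "prefix N ?y = prefix N x"
    proof -
      have "?y i = x i" if "i < N" for i
        using that \<open>\<not> k < N\<close> by (cases i) (auto simp: conc_def x_def nth_append simp del: replicate.simps)
      then show ?thesis
        by (simp add: subsequence_def)
    qed
    moreover have "?y \<in> ?G"
    proof -
      have "?u \<in> stems K"
        using that unfolding stems_def by blast
      then show ?thesis
        unfolding omega_power_stem_dictionary using conc_in_cylinder[OF \<open>?y \<in> topspace _\<close>] by blast
    qed
    ultimately show False
      using N by blast
  qed
  then have "K \<subseteq> {..<N}"
    by (simp add: subset_iff)
  then show "finite K"
    by (rule finite_subset) simp
qed

lemma fsigma_set_reduction:
  fixes Y :: "'b topology"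
  assumes "zero_dim_polish Y" "fsigma_in Y D" "n \<ge> 2"
  obtains f where "continuous_map Y (dict_space n) f"
    "D = {y \<in> topspace Y. f y \<in> {A. A \<subseteq> words n \<and> openin (omega_space n) (omega_power n A) \<and>
            closedin (omega_space n) (omega_power n A)}}"
proof -
  obtain K :: "'b \<Rightarrow> nat set" where K: "\<And>k. openin Y {y \<in> topspace Y. k \<in> K y}"
      "\<And>k. closedin Y {y \<in> topspace Y. k \<in> K y}"
      "\<And>y. y \<in> topspace Y \<Longrightarrow> finite (K y) \<longleftrightarrow> y \<in> D"
    using fsigma_finite_reduction[OF assms(1,2)] by metis
  let ?f = "\<lambda>y. stem_dictionary n (K y)"
  have stem: "openin Y {y \<in> topspace Y. u \<in> stems (K y)} \<and> closedin Y {y \<in> topspace Y. u \<in> stems (K y)}" for u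
  proof -
    define s where "s k = 0 # replicate (Suc k) 1 @ [0 :: nat]" for k
    have inj: "s k = s l \<longleftrightarrow> k = l" for k l
      by (auto simp: s_def dest: arg_cong[of _ _ length])
    \<comment> \<open>whether \<open>u\<close> is a stem for every parameter; if not, at most one number \<open>k\<close> decides\<close>
    define P where "P \<longleftrightarrow> u \<in> stems {}"
    have stems: "u \<in> stems L \<longleftrightarrow> P \<or> u \<in> s ` L" for L
      by (auto simp: P_def stems_def s_def)
    show ?thesis
    proof (cases "P \<or> u \<notin> range s")
      case True
      then have "u \<in> stems L \<longleftrightarrow> P" for L
        unfolding stems by blast
      then show ?thesis
        by (cases P) simp_all
    next
      case False
      then obtain k where k: "u = s k" "\<not> P"
        by auto
      then have "u \<in> stems L \<longleftrightarrow> k \<in> L" for L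
        unfolding stems using inj by auto
      then show ?thesis
        using K(1,2) by simp
    qed
  qed
  have "continuous_map Y (dict_space n) ?f"
  proof (rule continuous_map_into_dict_space)
    fix w assume w: "w \<in> words n"
    have "w \<in> ?f y \<longleftrightarrow> (\<exists>i\<le>length w. take i w \<in> stems (K y))" for y
    proof
      assume "w \<in> ?f y"
      then obtain u v where "u \<in> stems (K y)" "w = u @ v"
        by (auto simp: stem_dictionary_def)
      then show "\<exists>i\<le>length w. take i w \<in> stems (K y)"
        by (intro exI[of _ "length u"]) simp
    next
      assume "\<exists>i\<le>length w. take i w \<in> stems (K y)"
      then show "w \<in> ?f y"
        using w unfolding stem_dictionary_def by (metis (mono_tags, lifting) append_take_drop_id mem_Collect_eq)
    qed
    then have eq: "{y \<in> topspace Y. w \<in> ?f y} = (\<Union>i\<le>length w. {y \<in> topspace Y. take i w \<in> stems (K y)})"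
      by blast
    show "openin Y {y \<in> topspace Y. w \<in> ?f y}"
      unfolding eq using stem by (intro openin_Union) auto
    show "closedin Y {y \<in> topspace Y. w \<in> ?f y}"
      unfolding eq using stem by (intro closedin_Union) auto
  qed (auto simp: stem_dictionary_def)
  moreover have "?f y \<in> {A. A \<subseteq> words n \<and> openin (omega_space n) (omega_power n A) \<and>
      closedin (omega_space n) (omega_power n A)} \<longleftrightarrow> y \<in> D" if "y \<in> topspace Y" for y
    using K(3)[OF that] closedin_stem_dictionary_power_iff[OF assms(3), of "K y"]
      openin_stem_dictionary_power[of n "K y"]
    by (auto simp: stem_dictionary_def)
  moreover have "D \<subseteq> topspace Y"
    using assms(2) by (rule fsigma_in_subset)
  ultimately show thesis
    using that[of ?f] by blast
qed

section \<open>A countable dense set that is not \<open>G\<^sub>\<delta>\<close>\<close>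

lemma gdelta_in_continuous_map_preimage:
  assumes "continuous_map X Y f" "gdelta_in Y S"
  shows "gdelta_in X {x \<in> topspace X. f x \<in> S}"
proof -
  obtain C where C: "\<And>i. openin Y (C i)" "\<And>i. C (Suc i) \<subseteq> C i" "\<Inter>(range C) = S"
    using assms(2) unfolding gdelta_in_descending by blast
  let ?E = "\<lambda>i. {x \<in> topspace X. f x \<in> C i}"
  have "openin X (?E i)" for i
    using assms(1) C(1) by (rule openin_continuous_map_preimage)
  moreover have "?E (Suc i) \<subseteq> ?E i" for i
    using C(2) by blast
  moreover have "\<Inter>(range ?E) = {x \<in> topspace X. f x \<in> S}"
    using C(3) by blast
  ultimately show ?thesis
    unfolding gdelta_in_descending by (intro exI[of _ ?E]) simp
qed

text \<open>
  A neighbourhood constrains only finitely many words, so a word outside that set can be added or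
  removed to avoid \<open>A\<close>.
\<close>

lemma dict_space_no_isolated_points:
  assumes "n \<ge> 1" "A \<subseteq> words n"
  shows "dict_space n closure_of (topspace (dict_space n) - {A}) = topspace (dict_space n)"
proof -
  have "\<exists>B\<in>topspace (dict_space n) - {A}. B \<in> U" if U: "openin (dict_space n) U" "C \<in> U" for U C
  proof -
    obtain F where F: "finite F" "F \<subseteq> words n" "\<forall>A'\<subseteq>words n. A' \<inter> F = C \<inter> F \<longrightarrow> A' \<in> U"
      by (rule openin_dict_spaceE[OF U])
    have "inj (\<lambda>k. replicate k (0 :: nat))"
      by (auto simp: inj_def dest: arg_cong[of _ _ length])
    moreover have "range (\<lambda>k. replicate k 0) \<subseteq> words n"
      using assms(1) by (auto simp: words_def)
    ultimately have "infinite (words n)"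
      using finite_subset range_inj_infinite by blast
    then obtain w where w: "w \<in> words n" "w \<notin> F"
      using F(1) by (meson finite_subset subsetI)
    have C: "C \<subseteq> words n"
      using openin_subset[OF U(1)] U(2) by auto
    have "\<exists>B\<subseteq>words n. B \<inter> F = C \<inter> F \<and> B \<noteq> A"
    proof (cases "w \<in> A")
      case True
      then show ?thesis
        using C w by (intro exI[of _ "C - {w}"]) auto
    next
      case False
      then show ?thesis
        using C w by (intro exI[of _ "insert w C"]) auto
    qed
    then show ?thesis
      using F(3) by auto
  qed
  then show ?thesis
    unfolding closure_of_def using openin_subset by blast
qed

text \<open>
  If this countable dense set were an intersection of open sets \<open>E i\<close>, those would be dense, as would the
  complements of its singletons.  These countably many dense open sets have empty intersection, against
  Baire's theorem.
\<close>

lemma not_gdelta_finite_dictionaries: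
  assumes "n \<ge> 1"
  shows "\<not> gdelta_in (dict_space n) (finite_dictionaries n)"
proof
  let ?X = "dict_space n"
  assume "gdelta_in ?X (finite_dictionaries n)"
  then obtain E :: "nat \<Rightarrow> nat list set set"
    where E: "\<And>i. openin ?X (E i)" "\<Inter>(range E) = finite_dictionaries n"
    unfolding gdelta_in_descending by blast
  let ?\<O> = "range E \<union> (\<lambda>A. topspace ?X - {A}) ` finite_dictionaries n"
  have "?X closure_of \<Inter>?\<O> = topspace ?X"
  proof (rule Baire_category)
    show "countable ?\<O>"
      using countable_finite_dictionaries by simp
    fix T assume "T \<in> ?\<O>"
    then show "openin ?X T \<and> ?X closure_of T = topspace ?X"
    proof (elim UnE imageE)
      fix i assume i: "T = E i"
      have "finite_dictionaries n \<subseteq> T"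
        using E(2) i by blast
      then have "topspace ?X \<subseteq> ?X closure_of T"
        using closure_of_mono closure_of_finite_dictionaries by metis
      then show ?thesis
        using E(1) i closure_of_subset_topspace[of ?X T] by simp
    next
      fix A assume A: "A \<in> finite_dictionaries n" "T = topspace ?X - {A}"
      then have "A \<subseteq> words n"
        by (simp add: finite_dictionaries_def)
      then have "closedin ?X {A}"
        using Hausdorff_dict_space by (simp add: closedin_Hausdorff_sing_eq)
      then show ?thesis
        unfolding A(2) using dict_space_no_isolated_points[OF assms \<open>A \<subseteq> words n\<close>] by blast
    qed
  qed (simp add: completely_metrizable_dict_space)
  moreover have "\<Inter>?\<O> = finite_dictionaries n \<inter> (\<Inter>A\<in>finite_dictionaries n. topspace ?X - {A})"
    unfolding Inter_Un_distrib E(2) ..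
  then have "\<Inter>?\<O> = {}"
    by auto
  ultimately have "topspace ?X = {}"
    by (metis closure_of_empty)
  then show False
    using Pow_bottom[of "words n"] by simp
qed

lemma fsigma_finite_dictionaries: "fsigma_in (dict_space n) (finite_dictionaries n)"
proof -
  have "closedin (dict_space n) {A}" if "A \<in> finite_dictionaries n" for A
    using that Hausdorff_dict_space by (simp add: closedin_Hausdorff_sing_eq finite_dictionaries_def)
  then have "fsigma_in (dict_space n) (\<Union>((\<lambda>A. {A}) ` finite_dictionaries n))"
    using countable_finite_dictionaries by (intro fsigma_in_Union) (auto intro: closed_imp_fsigma_in)
  then show ?thesis
    by simp
qed

section \<open>The complexity of emptiness, fullness and clopenness\<close>

theorem theorem4:
  fixes n :: nat
  assumes "n \<ge> 2"
  shows
    "({A. A \<subseteq> words n \<and> omega_power n A = {}} = {{}, {[]}} \<and>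
      class_complete TYPE('b) Pi01 (dict_space n)
        {A. A \<subseteq> words n \<and> omega_power n A = {}}) \<and>
     (in_class Sigma01 (dict_space n)
        {A. A \<subseteq> words n \<and> omega_power n A = topspace (omega_space n)} \<and>
      dict_space n closure_of
        {A. A \<subseteq> words n \<and> omega_power n A = topspace (omega_space n)} = topspace (dict_space n) \<and>
      class_complete TYPE('b) Sigma01 (dict_space n)
        {A. A \<subseteq> words n \<and> omega_power n A = topspace (omega_space n)}) \<and>
     (k_sigma_in (dict_space n)
        {A. A \<subseteq> words n \<and> openin (omega_space n) (omega_power n A) \<and>
            closedin (omega_space n) (omega_power n A)} \<and>
      \<not> in_class Pi02 (dict_space n)
        {A. A \<subseteq> words n \<and> openin (omega_space n) (omega_power n A) \<and>
            closedin (omega_space n) (omega_power n A)} \<and>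
      class_complete TYPE('b) Sigma02 (dict_space n)
        {A. A \<subseteq> words n \<and> openin (omega_space n) (omega_power n A) \<and>
            closedin (omega_space n) (omega_power n A)})"
    (is "(?E = _ \<and> _) \<and> (_ \<and> _ \<and> class_complete _ _ _ ?F) \<and> (_ \<and> _ \<and> class_complete _ _ _ ?C)")
proof -
  let ?X = "dict_space n"
  have n: "n \<ge> 1"
    using assms by simp
  have "(\<lambda>_. 0) \<in> topspace (omega_space n)"
    using n by (auto simp: topspace_omega_space)
  then have ne: "topspace (omega_space n) \<noteq> {}" "{} \<noteq> topspace (omega_space n)"
    by blast+
  note polish = zero_dim_polish_dict_space[of n]

  have E: "?E = {{}, {[]}}"
  proof -
    have "?E = {A. A \<subseteq> {[]} \<and> A \<subseteq> words n}"
      using omega_power_eq_empty_iff by blast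
    also have "\<dots> = {{}, {[]}}"
      by (auto simp: words_def subset_singleton_iff)
    finally show ?thesis .
  qed
  have "closedin ?X ?E"
    unfolding E using Hausdorff_dict_space
    by (intro closedin_Hausdorff_finite) (auto simp: words_def)
  moreover have "\<exists>f. continuous_map Y ?X f \<and> D = {y \<in> topspace Y. f y \<in> ?E}"
    if Y: "zero_dim_polish Y" "closedin Y D" for Y :: "'b topology" and D
  proof -
    have "openin Y (topspace Y - D)"
      using Y(2) by blast
    then obtain f where f: "continuous_map Y ?X f"
        "\<And>y. y \<in> topspace Y - D \<Longrightarrow> omega_power n (f y) = topspace (omega_space n)"
        "\<And>y. y \<notin> topspace Y - D \<Longrightarrow> omega_power n (f y) = {}"
      using open_set_reduction[OF Y(1) _ n] by metis
    have sub: "f y \<subseteq> words n" if "y \<in> topspace Y" for y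
      using continuous_map_image_subset_topspace[OF f(1)] that by auto
    have "f y \<in> ?E \<longleftrightarrow> y \<in> D" if "y \<in> topspace Y" for y
      using f(2,3)[of y] sub[OF that] that ne by (cases "y \<in> D") auto
    then have "D = {y \<in> topspace Y. f y \<in> ?E}"
      using closedin_subset[OF Y(2)] by blast
    with f(1) show ?thesis by blast
  qed
  ultimately have E_complete: "class_complete TYPE('b) Pi01 ?X ?E"
    unfolding class_complete_def using polish by simp

  have F_reduction: "\<exists>f. continuous_map Y ?X f \<and> D = {y \<in> topspace Y. f y \<in> ?F}"
    if Y: "zero_dim_polish Y" "openin Y D" for Y :: "'b topology" and D
  proof -
    obtain f where f: "continuous_map Y ?X f"
        "\<And>y. y \<in> D \<Longrightarrow> omega_power n (f y) = topspace (omega_space n)"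
        "\<And>y. y \<notin> D \<Longrightarrow> omega_power n (f y) = {}"
      using open_set_reduction[OF Y n] by metis
    have sub: "f y \<subseteq> words n" if "y \<in> topspace Y" for y
      using continuous_map_image_subset_topspace[OF f(1)] that by auto
    have "f y \<in> ?F \<longleftrightarrow> y \<in> D" if "y \<in> topspace Y" for y
      using f(2,3)[of y] sub[OF that] ne by (cases "y \<in> D") auto
    then have "D = {y \<in> topspace Y. f y \<in> ?F}"
      using openin_subset[OF Y(2)] by blast
    with f(1) show ?thesis by blast
  qed
  have F_complete: "class_complete TYPE('b) Sigma01 ?X ?F"
    unfolding class_complete_def using polish openin_full_power F_reduction by simp

  obtain \<K> where \<K>: "countable \<K>" "\<And>K. K \<in> \<K> \<Longrightarrow> closedin ?X K" "\<Union>\<K> = ?C"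
    by (rule clopen_powers_countable_Union_closed) (rule that)
  have C_K_sigma: "k_sigma_in ?X ?C"
    unfolding k_sigma_in_def union_of_def
    using \<K> closedin_compact_space[OF compact_space_dict_space] by (intro exI[of _ \<K>]) auto
  have "fsigma_in ?X ?C"
    using \<K> fsigma_in_Union[of \<K> ?X] closed_imp_fsigma_in by metis
  moreover have "\<exists>f. continuous_map Y ?X f \<and> D = {y \<in> topspace Y. f y \<in> ?C}"
    if Y: "zero_dim_polish Y" "fsigma_in Y D" for Y :: "'b topology" and D
    by (rule fsigma_set_reduction[OF Y assms]) (intro exI conjI)
  ultimately have C_complete: "class_complete TYPE('b) Sigma02 ?X ?C"
    unfolding class_complete_def using polish by simp

  have C_not_gdelta: "\<not> gdelta_in ?X ?C"
  proof
    assume "gdelta_in ?X ?C"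
    obtain f where f: "continuous_map ?X ?X f" "finite_dictionaries n = {A \<in> topspace ?X. f A \<in> ?C}"
      by (rule fsigma_set_reduction[OF polish fsigma_finite_dictionaries assms])
    have "gdelta_in ?X (finite_dictionaries n)"
      unfolding f(2) by (rule gdelta_in_continuous_map_preimage[OF f(1) \<open>gdelta_in ?X ?C\<close>])
    with not_gdelta_finite_dictionaries[OF n] show False ..
  qed

  show ?thesis
    using E E_complete openin_full_power dense_full_power F_complete C_K_sigma C_complete C_not_gdelta
    by simp
qed

end
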